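(* Let $\mu$ be a measure on a measurable space $(\mathcal X,\mathcal A)$, let $e_1,e_2,\dots$ be an orthonormal basis of $L_2(\mathcal X,\mathcal A,\mu)$, and let $\mathcal F\subset L_2(\mathcal X,\mathcal A,\mu)$ be a uniformly bounded collection of probability densities relative to $\mu$. Let $\Theta\subset\ell_2$ be the set of sequences of Fourier coefficients $\theta=(\theta_1,\theta_2,\dots)$, $\theta_i=\int f e_i\,d\mu$, of the densities $f\in\mathcal F$. For $\theta\in\Theta$ corresponding to $f\in\mathcal F$ let, under $P_\theta$, $X_1,\dots,X_n$ ($n\ge2$) be an i.i.d. sample from the density $f$, and let $\hat\theta^{(n)}$ be an initial estimator that is independent of $X_1,\dots,X_n$. Define $$R_{k,n}(\hat\theta^{(n)})=\frac1{n(n-1)}\sum_{\substack{r,s=1\\ r\ne s}}^n\ \sum_{i=1}^k(e_i(X_r)-\hat\theta_i^{(n)})(e_i(X_s)-\hat\theta_i^{(n)}),$$ $$\hat\tau_{k,n,\theta}^2=\frac{2k\|f\|_\infty^2}{n(n-1)}+\frac{4\|f\|_\infty}{n}\sum_{i=1}^k(\theta_i-\hat\theta_i^{(n)})^2 .$$ Then for any $k,n$, $$\sup_{\theta\in\Theta}E_\theta\left(\left(\frac{R_{k,n}(\hat\theta^{(n)})-\sum_{i=1}^k(\theta_i-\hat\theta_i^{(n)})^2}{\hat\tau_{k,n,\theta}}\right)^2\ \Big|\ \hat\theta^{(n)}\right)\le1 .$$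
   Context: $\|f\|_\infty$ is the supremum norm of the density $f$. The initial estimator $\hat\theta^{(n)}$ is a random element of $\ell_2$ (square-summable real sequences) based on data independent of $X_1,\dots,X_n$ (obtained by sample splitting); the conditional expectation given $\hat\theta^{(n)}$ is computed by treating $\hat\theta^{(n)}$ as fixed at its value and using only the law of $X_1,\dots,X_n$ under $\theta$. *)

theory Defs
  imports "HOL-Probability.Probability"
begin

text \<open>
  Elements of \<open>L\<^sub>2(M)\<close> are represented by real functions that are only identified up to
  \<open>M\<close>-null sets; all notions below are invariant under changes on null sets.
  Sequences are indexed from 0: \<open>e 0, e 1, \<dots>\<close> stand for \<open>e\<^sub>1, e\<^sub>2, \<dots>\<close>, so that
  sums over \<open>i < k\<close> have the first \<open>k\<close> basis functions as summands.
\<close>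

definition L2 :: "'a measure \<Rightarrow> ('a \<Rightarrow> real) set" where
  "L2 M = {f \<in> borel_measurable M. integrable M (\<lambda>x. (f x)\<^sup>2)}"

definition L2_inner :: "'a measure \<Rightarrow> ('a \<Rightarrow> real) \<Rightarrow> ('a \<Rightarrow> real) \<Rightarrow> real" where
  "L2_inner M f g = (\<integral>x. f x * g x \<partial>M)"

definition orthonormal_basis_L2 :: "'a measure \<Rightarrow> (nat \<Rightarrow> 'a \<Rightarrow> real) \<Rightarrow> bool" where
  "orthonormal_basis_L2 M e \<longleftrightarrow>
     (\<forall>i. e i \<in> L2 M) \<and>
     (\<forall>i j. L2_inner M (e i) (e j) = (if i = j then 1 else 0)) \<and>
     (\<forall>g \<in> L2 M. (\<lambda>N. \<integral>x. (g x - (\<Sum>i<N. L2_inner M g (e i) * e i x))\<^sup>2 \<partial>M) \<longlonglongrightarrow> 0)"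

definition prob_density :: "'a measure \<Rightarrow> ('a \<Rightarrow> real) \<Rightarrow> bool" where
  "prob_density M f \<longleftrightarrow>
     f \<in> borel_measurable M \<and> (AE x in M. 0 \<le> f x) \<and> (\<integral>\<^sup>+x. ennreal (f x) \<partial>M) = 1"

definition uniformly_bounded :: "'a measure \<Rightarrow> ('a \<Rightarrow> real) set \<Rightarrow> bool" where
  "uniformly_bounded M F \<longleftrightarrow> (\<exists>B. \<forall>f\<in>F. AE x in M. \<bar>f x\<bar> \<le> B)"

text \<open>
  The supremum norm of an element of \<open>L\<^sub>2(M)\<close>, which does not depend on the chosen version of
  the function. It is at most the pointwise supremum of any version, and attained as the
  pointwise supremum of some version.
\<close>

definition sup_norm :: "'a measure \<Rightarrow> ('a \<Rightarrow> real) \<Rightarrow> real" where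
  "sup_norm M f = real_of_ereal (esssup M (\<lambda>x. ereal \<bar>f x\<bar>))"

definition fourier_coeffs :: "'a measure \<Rightarrow> (nat \<Rightarrow> 'a \<Rightarrow> real) \<Rightarrow> ('a \<Rightarrow> real) \<Rightarrow> nat \<Rightarrow> real" where
  "fourier_coeffs M e f = (\<lambda>i. L2_inner M f (e i))"

definition Theta :: "'a measure \<Rightarrow> (nat \<Rightarrow> 'a \<Rightarrow> real) \<Rightarrow> ('a \<Rightarrow> real) set \<Rightarrow> (nat \<Rightarrow> real) set" where
  "Theta M e F = fourier_coeffs M e ` F"

text \<open>
  The space \<open>\<ell>\<^sub>2\<close> with the \<open>\<sigma>\<close>-algebra generated by the coordinates, which is its Borel
  \<open>\<sigma>\<close>-algebra.
\<close>

definition ell2 :: "(nat \<Rightarrow> real) measure" where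
  "ell2 = restrict_space (Pi\<^sub>M UNIV (\<lambda>_. borel)) {t. summable (\<lambda>i. (t i)\<^sup>2)}"

definition iid_sample ::
    "'w measure \<Rightarrow> 'a measure \<Rightarrow> nat \<Rightarrow> (nat \<Rightarrow> 'w \<Rightarrow> 'a) \<Rightarrow> ('a \<Rightarrow> real) \<Rightarrow> bool" where
  "iid_sample Q M n X f \<longleftrightarrow>
     prob_space.indep_vars Q (\<lambda>_. M) X {..<n} \<and>
     (\<forall>r<n. distributed Q M (X r) (\<lambda>x. ennreal (f x)))"

text \<open>
  The library constant \<open>indep_var\<close> requires both random variables to have the same type, whereas
  the sample and the estimator have different types.
\<close>

definition indep_rv ::
    "'w measure \<Rightarrow> 'b measure \<Rightarrow> ('w \<Rightarrow> 'b) \<Rightarrow> 'c measure \<Rightarrow> ('w \<Rightarrow> 'c) \<Rightarrow> bool" where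
  "indep_rv Q A U B V \<longleftrightarrow>
     U \<in> measurable Q A \<and> V \<in> measurable Q B \<and>
     prob_space.indep_set Q
       {U -` S \<inter> space Q |S. S \<in> sets A} {V -` S \<inter> space Q |S. S \<in> sets B}"

text \<open>The statistic \<open>R\<^bsub>k,n\<^esub>(t)\<close> evaluated at the sample values \<open>x 0, \<dots>, x (n - 1)\<close>.\<close>

definition R_stat ::
    "(nat \<Rightarrow> 'a \<Rightarrow> real) \<Rightarrow> nat \<Rightarrow> nat \<Rightarrow> (nat \<Rightarrow> real) \<Rightarrow> (nat \<Rightarrow> 'a) \<Rightarrow> real" where
  "R_stat e k n t x =
     1 / (real n * (real n - 1)) *
       (\<Sum>r<n. \<Sum>s\<in>{..<n} - {r}. \<Sum>i<k. (e i (x r) - t i) * (e i (x s) - t i))"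

definition sq_dist :: "nat \<Rightarrow> (nat \<Rightarrow> real) \<Rightarrow> (nat \<Rightarrow> real) \<Rightarrow> real" where
  "sq_dist k \<theta> t = (\<Sum>i<k. (\<theta> i - t i)\<^sup>2)"

definition tau ::
    "'a measure \<Rightarrow> nat \<Rightarrow> nat \<Rightarrow> ('a \<Rightarrow> real) \<Rightarrow> (nat \<Rightarrow> real) \<Rightarrow> (nat \<Rightarrow> real) \<Rightarrow> real" where
  "tau M k n f \<theta> t =
     sqrt (2 * real k * (sup_norm M f)\<^sup>2 / (real n * (real n - 1))
           + 4 * sup_norm M f / real n * sq_dist k \<theta> t)"

text \<open>
  The conditional expectation given the initial estimator \<open>T\<close> of a nonnegative function \<open>g\<close> of
  the sample \<open>X 0, \<dots>, X (n - 1)\<close> and of \<open>T\<close>, for \<open>T\<close> independent of the sample: the estimator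
  is frozen at its value \<open>T \<omega>\<close> and the expectation is taken over the law of the sample under
  \<open>Q\<close>.
\<close>

definition cond_expectation_given ::
    "'w measure \<Rightarrow> 'a measure \<Rightarrow> nat \<Rightarrow> (nat \<Rightarrow> 'w \<Rightarrow> 'a) \<Rightarrow> ('w \<Rightarrow> nat \<Rightarrow> real)
      \<Rightarrow> ((nat \<Rightarrow> 'a) \<Rightarrow> (nat \<Rightarrow> real) \<Rightarrow> ennreal) \<Rightarrow> 'w \<Rightarrow> ennreal" where
  "cond_expectation_given Q M n X T g \<omega> =
     (\<integral>\<^sup>+x. g x (T \<omega>) \<partial>distr Q (Pi\<^sub>M {..<n} (\<lambda>_. M)) (\<lambda>\<omega>'. \<lambda>r\<in>{..<n}. X r \<omega>'))"

end

theory Submission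
  imports Defs
begin

text \<open>
  Fix the value \<open>t\<close> of the estimator, put \<open>D\<^sub>i = e\<^sub>i - \<theta>\<^sub>i\<close> and \<open>a\<^sub>i = \<theta>\<^sub>i - t\<^sub>i\<close>, and let \<open>C\<close> be the
  covariance matrix of \<open>e\<^sub>1(X\<^sub>1), \<dots>, e\<^sub>k(X\<^sub>1)\<close>. Multiplying out
  \<open>(D\<^sub>i(X\<^sub>r) + a\<^sub>i) (D\<^sub>i(X\<^sub>s) + a\<^sub>i)\<close> gives the Hoeffding decomposition of the error of the
  statistic (\<open>R_stat_hoeffding_decomposition\<close>): its constant part is the squared distance that is
  being estimated, and what remains is a quadratic part
  \<open>2 / (n (n - 1)) \<Sum>\<^sub>i \<Sum> D\<^sub>i(X\<^sub>r) D\<^sub>i(X\<^sub>s)\<close> over the two-element sets \<open>{r, s}\<close> and a linear part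
  \<open>2 / n \<Sum>\<^sub>i a\<^sub>i \<Sum>\<^sub>r D\<^sub>i(X\<^sub>r)\<close>.

  Since the \<open>D\<^sub>i\<close> are centred and the observations independent, terms that belong to different
  index sets \<open>{r, s}\<close> or \<open>{r}\<close> are orthogonal (\<open>hoeffding_orthogonality\<close>). Hence the mean square
  error is exactly
  \<open>2 / (n (n - 1)) \<Sum>\<^sub>i\<^sub>j C\<^sub>i\<^sub>j\<^sup>2 + 4 / n \<Sum>\<^sub>i\<^sub>j a\<^sub>i a\<^sub>j C\<^sub>i\<^sub>j\<close>.

  The quadratic form of \<open>C\<close> at \<open>b\<close> is the variance of \<open>w(X\<^sub>1)\<close> with \<open>w = \<Sum>\<^sub>i b\<^sub>i e\<^sub>i\<close>. A variance is at
  most the second moment, the density is at most its supremum norm \<open>s\<close>, and the \<open>e\<^sub>i\<close> are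
  orthonormal, so the form is at most \<open>s \<Sum>\<^sub>i b\<^sub>i\<^sup>2\<close> (\<open>covariance_quadratic_form_bounds\<close>). This
  bounds the second summand directly. It also says that all eigenvalues of \<open>C\<close> lie in \<open>[0, s]\<close>, so
  that the squared Frobenius norm is at most \<open>k s\<^sup>2\<close>
  (\<open>frobenius_le_of_quadratic_form_bounds\<close>), which bounds the first summand. The two bounds add
  up to the square of the normalising factor.
\<close>

section \<open>Symmetric sums over pairs of distinct indices\<close>

lemma sum_distinct_pairs_insert:
  fixes h :: "'i \<Rightarrow> 'i \<Rightarrow> real"
  assumes "finite A" "a \<notin> A"
  shows "(\<Sum>r\<in>insert a A. \<Sum>s\<in>insert a A - {r}. h r s)
       = (\<Sum>r\<in>A. \<Sum>s\<in>A - {r}. h r s) + (\<Sum>r\<in>A. h a r + h r a)"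
proof -
  have "(\<Sum>s\<in>insert a A - {r}. h r s) = h r a + (\<Sum>s\<in>A - {r}. h r s)" if "r \<in> A" for r
  proof -
    have "insert a A - {r} = insert a (A - {r})" using that assms by auto
    then show ?thesis using assms by simp
  qed
  moreover have "insert a A - {a} = A" using assms by auto
  ultimately show ?thesis using assms by (simp add: sum.distrib)
qed

text \<open>
  The two orders of a pair of indices give the same product. Passing to two-element sets identifies
  them, so that distinct summands become orthogonal random variables.
\<close>

lemma sum_distinct_pairs_eq_subsets:
  fixes y :: "'i \<Rightarrow> real"
  assumes "finite A"
  shows "(\<Sum>r\<in>A. \<Sum>s\<in>A - {r}. y r * y s) = 2 * (\<Sum>S | S \<subseteq> A \<and> card S = 2. \<Prod>q\<in>S. y q)"
  using assms
proof (induction A)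
  case empty
  have "{S. S \<subseteq> {} \<and> card S = 2} = ({} :: 'i set set)" by auto
  then show ?case by simp
next
  case (insert a A)
  let ?P = "\<lambda>A. {S. S \<subseteq> A \<and> card S = 2}"
  have split: "?P (insert a A) = ?P A \<union> (\<lambda>r. {a, r}) ` A"
  proof (intro equalityI subsetI)
    fix S assume S: "S \<in> ?P (insert a A)"
    then obtain p q where pq: "S = {p, q}" "p \<noteq> q" by (auto simp: card_2_iff)
    then show "S \<in> ?P A \<union> (\<lambda>r. {a, r}) ` A"
      using S by (auto simp: insert_commute)
  next
    fix S assume "S \<in> ?P A \<union> (\<lambda>r. {a, r}) ` A"
    then show "S \<in> ?P (insert a A)" using insert.hyps by (auto simp: card_insert_if)
  qed
  have "(\<Sum>S\<in>?P (insert a A). \<Prod>q\<in>S. y q)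
      = (\<Sum>S\<in>?P A. \<Prod>q\<in>S. y q) + (\<Sum>S\<in>(\<lambda>r. {a, r}) ` A. \<Prod>q\<in>S. y q)"
    unfolding split using insert.hyps
    by (intro sum.union_disjoint) (auto intro: finite_subset[of _ "Pow A"])
  also have "(\<Sum>S\<in>(\<lambda>r. {a, r}) ` A. \<Prod>q\<in>S. y q) = (\<Sum>r\<in>A. \<Prod>q\<in>{a, r}. y q)"
    by (subst sum.reindex) (auto simp: inj_on_def doubleton_eq_iff)
  also have "\<dots> = (\<Sum>r\<in>A. y a * y r)"
    using insert.hyps by (intro sum.cong refl) (subst prod.insert, auto)
  finally show ?case
    unfolding sum_distinct_pairs_insert[OF insert.hyps] insert.IH
    by (simp add: mult.commute sum_distrib_left)
qed

text \<open>
  For centred \<open>y\<close>, the three summands on the right are the quadratic, linear and constant parts of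
  the sum on the left.
\<close>

lemma sum_distinct_pairs_shift:
  fixes y :: "nat \<Rightarrow> real"
  shows "(\<Sum>r<n. \<Sum>s\<in>{..<n} - {r}. (y r + a) * (y s + a))
       = (\<Sum>r<n. \<Sum>s\<in>{..<n} - {r}. y r * y s)
         + 2 * (real n - 1) * a * (\<Sum>r<n. y r) + real n * (real n - 1) * a\<^sup>2"
proof (induction n)
  case 0
  then show ?case by simp
next
  case (Suc n)
  have n: "n \<notin> {..<n}" by simp
  have "(\<Sum>r<n. (y n + a) * (y r + a) + (y r + a) * (y n + a))
      = 2 * (y n + a) * (\<Sum>r<n. y r) + 2 * real n * (y n + a) * a"
    by (simp add: algebra_simps sum.distrib sum_distrib_left)
  moreover have "(\<Sum>r<n. y n * y r + y r * y n) = 2 * y n * (\<Sum>r<n. y r)"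
    by (simp add: algebra_simps sum_distrib_left)
  ultimately
  show ?case
    unfolding lessThan_Suc sum_distinct_pairs_insert[OF finite_lessThan n] Suc.IH
    by (simp add: algebra_simps power2_eq_square)
qed

section \<open>Hoeffding decomposition\<close>

lemma integrable_mult_of_square_integrable:
  fixes u v :: "'b \<Rightarrow> real"
  assumes [measurable]: "u \<in> borel_measurable N" "v \<in> borel_measurable N"
    and "integrable N (\<lambda>x. (u x)\<^sup>2)" "integrable N (\<lambda>x. (v x)\<^sup>2)"
  shows "integrable N (\<lambda>x. u x * v x)"
proof (rule Bochner_Integration.integrable_bound)
  show "integrable N (\<lambda>x. (u x)\<^sup>2 + (v x)\<^sup>2)" using assms by auto
  have "\<bar>u x * v x\<bar> \<le> (u x)\<^sup>2 + (v x)\<^sup>2" for x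
  proof -
    have "2 * (\<bar>u x\<bar> * \<bar>v x\<bar>) \<le> \<bar>u x\<bar>\<^sup>2 + \<bar>v x\<bar>\<^sup>2"
      using sum_squares_bound[of "\<bar>u x\<bar>" "\<bar>v x\<bar>"] by simp
    moreover have "0 \<le> \<bar>u x\<bar> * \<bar>v x\<bar>" by simp
    ultimately show ?thesis unfolding abs_mult by (simp only: power2_abs)
  qed
  then show "AE x in N. norm (u x * v x) \<le> norm ((u x)\<^sup>2 + (v x)\<^sup>2)" by auto
qed auto

text \<open>
  An index that belongs to only one of the two sets contributes a single centred factor, which
  independence splits off as a factor \<open>0\<close> of the expectation. Square integrability of \<open>u\<close> and
  \<open>v\<close> suffices, although products of more than two factors occur: no observation enters
  a product more than twice.
\<close>

lemma (in prob_space) hoeffding_orthogonality: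
  fixes X :: "'i \<Rightarrow> 'a \<Rightarrow> 'b" and u v :: "'b \<Rightarrow> real"
  assumes I: "finite I" and ind: "indep_vars (\<lambda>_. N) X I"
    and law: "\<And>q. q \<in> I \<Longrightarrow> distr M N (X q) = L"
    and u[measurable]: "u \<in> borel_measurable N" and v[measurable]: "v \<in> borel_measurable N"
    and u2: "integrable L (\<lambda>x. (u x)\<^sup>2)" and v2: "integrable L (\<lambda>x. (v x)\<^sup>2)"
    and u0: "(\<integral>x. u x \<partial>L) = 0" and v0: "(\<integral>x. v x \<partial>L) = 0"
    and S: "S \<subseteq> I" and S': "S' \<subseteq> I"
  shows "integrable M (\<lambda>\<omega>. (\<Prod>q\<in>S. u (X q \<omega>)) * (\<Prod>q\<in>S'. v (X q \<omega>)))"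
    and "expectation (\<lambda>\<omega>. (\<Prod>q\<in>S. u (X q \<omega>)) * (\<Prod>q\<in>S'. v (X q \<omega>)))
         = (if S = S' then (\<integral>x. u x * v x \<partial>L) ^ card S else 0)"
proof -
  have X[measurable]: "random_variable N (X q)" if "q \<in> I" for q
    using ind that by (auto simp: indep_vars_def)
  have int_eq: "integrable M (\<lambda>\<omega>. w (X q \<omega>)) = integrable L w"
      "expectation (\<lambda>\<omega>. w (X q \<omega>)) = (\<integral>x. w x \<partial>L)"
    if "q \<in> I" "w \<in> borel_measurable N" for q and w :: "'b \<Rightarrow> real"
    using that X[OF that(1)]
    by (simp_all add: law[OF that(1), symmetric] integrable_distr_eq integral_distr)
  have L_prob: "prob_space L" if "q \<in> I" for q
    using law[OF that] prob_space_distr[OF X[OF that]] by simp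
  have sets_L: "sets L = sets N" if "q \<in> I" for q
    using law[OF that] by (metis sets_distr)
  have square: "integrable L w"
    if "q \<in> I" "w \<in> borel_measurable N" "integrable L (\<lambda>x. (w x)\<^sup>2)" for q and w :: "'b \<Rightarrow> real"
  proof -
    interpret L: prob_space L using L_prob[OF that(1)] .
    show ?thesis
      using that(2,3) L.square_integrable_imp_integrable measurable_cong_sets[OF sets_L[OF that(1)] refl]
      by blast
  qed
  \<comment> \<open>Completing both monomials by factors \<open>1\<close> makes the product a product of functions of
    one observation each, over all of \<open>I\<close>.\<close>
  define g where "g q x = (if q \<in> S then u x else 1) * (if q \<in> S' then v x else 1)" for q x
  have g[measurable]: "g q \<in> borel_measurable N" for q
    unfolding g_def by (cases "q \<in> S"; cases "q \<in> S'") simp_all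
  have g_int: "integrable M (\<lambda>\<omega>. g q (X q \<omega>))" if q: "q \<in> I" for q
  proof -
    have m: "u \<in> borel_measurable L" "v \<in> borel_measurable L"
      using u v by (simp_all add: measurable_cong_sets[OF sets_L[OF q] refl])
    have "integrable L (g q)"
      unfolding g_def
      using square[OF q u u2] square[OF q v v2] integrable_mult_of_square_integrable[OF m u2 v2]
        prob_space.finite_measure[OF L_prob[OF q]]
      by (cases "q \<in> S"; cases "q \<in> S'") (simp_all add: finite_measure.integrable_const)
    then show ?thesis using int_eq(1)[OF q g] by simp
  qed
  have g_ind: "indep_vars (\<lambda>_. borel) (\<lambda>q \<omega>. g q (X q \<omega>)) I"
    by (rule indep_vars_compose2[OF ind]) simp
  have prod_g: "(\<Prod>q\<in>I. g q (X q \<omega>)) = (\<Prod>q\<in>S. u (X q \<omega>)) * (\<Prod>q\<in>S'. v (X q \<omega>))" for \<omega>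
    unfolding g_def prod.distrib
    using I S S' by (simp add: prod.If_cases Int_absorb1)
  show "integrable M (\<lambda>\<omega>. (\<Prod>q\<in>S. u (X q \<omega>)) * (\<Prod>q\<in>S'. v (X q \<omega>)))"
    using indep_vars_integrable[OF I g_ind g_int] by (simp add: prod_g)
  have E: "expectation (\<lambda>\<omega>. (\<Prod>q\<in>S. u (X q \<omega>)) * (\<Prod>q\<in>S'. v (X q \<omega>)))
      = (\<Prod>q\<in>I. \<integral>x. g q x \<partial>L)"
    using indep_vars_lebesgue_integral[OF I g_ind g_int] by (simp add: prod_g int_eq(2))
  show "expectation (\<lambda>\<omega>. (\<Prod>q\<in>S. u (X q \<omega>)) * (\<Prod>q\<in>S'. v (X q \<omega>)))
      = (if S = S' then (\<integral>x. u x * v x \<partial>L) ^ card S else 0)"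
  proof (cases "S = S'")
    case True
    have "(\<Prod>q\<in>I. \<integral>x. g q x \<partial>L) = (\<Prod>q\<in>I. if q \<in> S then \<integral>x. u x * v x \<partial>L else 1)"
      using True L_prob by (intro prod.cong) (auto simp: g_def prob_space.prob_space)
    also have "\<dots> = (\<integral>x. u x * v x \<partial>L) ^ card S"
      using I S by (simp add: prod.If_cases Int_absorb1)
    finally show ?thesis using True E by simp
  next
    case False
    then obtain q where q: "q \<in> I" "(q \<in> S) \<noteq> (q \<in> S')" using S S' by blast
    then have "(\<integral>x. g q x \<partial>L) = 0" using u0 v0 by (auto simp: g_def)
    then show ?thesis using False E I q(1) by (auto simp: prod_zero_iff)
  qed
qed

text \<open>
  All terms in the expanded square that pair different index sets vanish by orthogonality. In the
  remaining ones, every element of \<open>S\<close> contributes one factor \<open>\<integral>x. D i x * D j x \<partial>L\<close>.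
\<close>

lemma (in prob_space) hoeffding_second_moment:
  fixes X :: "'i \<Rightarrow> 'a \<Rightarrow> 'b" and D :: "nat \<Rightarrow> 'b \<Rightarrow> real" and c :: "'i set \<Rightarrow> nat \<Rightarrow> real"
  assumes I: "finite I" and ind: "indep_vars (\<lambda>_. N) X I"
    and law: "\<And>q. q \<in> I \<Longrightarrow> distr M N (X q) = L"
    and D: "\<And>i. i < k \<Longrightarrow> D i \<in> borel_measurable N"
    and D2: "\<And>i. i < k \<Longrightarrow> integrable L (\<lambda>x. (D i x)\<^sup>2)"
    and D0: "\<And>i. i < k \<Longrightarrow> (\<integral>x. D i x \<partial>L) = 0"
    and F: "F \<subseteq> Pow I"
  shows "integrable M (\<lambda>\<omega>. (\<Sum>S\<in>F. \<Sum>i<k. c S i * (\<Prod>q\<in>S. D i (X q \<omega>)))\<^sup>2)"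
    and "expectation (\<lambda>\<omega>. (\<Sum>S\<in>F. \<Sum>i<k. c S i * (\<Prod>q\<in>S. D i (X q \<omega>)))\<^sup>2)
       = (\<Sum>S\<in>F. \<Sum>i<k. \<Sum>j<k. c S i * c S j * (\<integral>x. D i x * D j x \<partial>L) ^ card S)"
proof -
  have finF: "finite F" using F I by (auto intro: finite_subset[of _ "Pow I"])
  let ?m = "\<lambda>S i \<omega>. \<Prod>q\<in>S. D i (X q \<omega>)"
  note orth = hoeffding_orthogonality[OF I ind law D D D2 D2 D0 D0]
  have int: "integrable M (\<lambda>\<omega>. ?m S i \<omega> * ?m S' j \<omega>)"
    if "S \<in> F" "S' \<in> F" "i < k" "j < k" for S S' i j
    using that F by (intro orth(1)) auto
  have E: "expectation (\<lambda>\<omega>. ?m S i \<omega> * ?m S' j \<omega>)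
      = (if S = S' then (\<integral>x. D i x * D j x \<partial>L) ^ card S else 0)"
    if "S \<in> F" "S' \<in> F" "i < k" "j < k" for S S' i j
    using that F by (intro orth(2)) auto
  have expand: "(\<Sum>S\<in>F. \<Sum>i<k. c S i * ?m S i \<omega>)\<^sup>2
      = (\<Sum>S\<in>F. \<Sum>i<k. \<Sum>S'\<in>F. \<Sum>j<k. c S i * c S' j * (?m S i \<omega> * ?m S' j \<omega>))" for \<omega>
    unfolding power2_eq_square sum_distrib_right sum_distrib_left
    by (intro sum.cong refl) (simp add: mult_ac)
  let ?c = "\<lambda>S i S' j. if S = S' then (\<integral>x. D i x * D j x \<partial>L) ^ card S else 0"
  have mono: "has_bochner_integral M (\<lambda>\<omega>. ?m S i \<omega> * ?m S' j \<omega>) (?c S i S' j)"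
    if "S \<in> F" "S' \<in> F" "i < k" "j < k" for S S' i j
    using int[OF that] E[OF that] by (simp add: has_bochner_integral_iff)
  have "has_bochner_integral M (\<lambda>\<omega>. (\<Sum>S\<in>F. \<Sum>i<k. c S i * ?m S i \<omega>)\<^sup>2)
      (\<Sum>S\<in>F. \<Sum>i<k. \<Sum>S'\<in>F. \<Sum>j<k. c S i * c S' j * ?c S i S' j)"
    unfolding expand
    by (intro has_bochner_integral_sum has_bochner_integral_mult_right mono) auto
  then have int_sum: "integrable M (\<lambda>\<omega>. (\<Sum>S\<in>F. \<Sum>i<k. c S i * ?m S i \<omega>)\<^sup>2)"
    and E_sum: "expectation (\<lambda>\<omega>. (\<Sum>S\<in>F. \<Sum>i<k. c S i * ?m S i \<omega>)\<^sup>2)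
      = (\<Sum>S\<in>F. \<Sum>i<k. \<Sum>S'\<in>F. \<Sum>j<k. c S i * c S' j * ?c S i S' j)"
    by (simp_all add: has_bochner_integral_iff)
  show "integrable M (\<lambda>\<omega>. (\<Sum>S\<in>F. \<Sum>i<k. c S i * ?m S i \<omega>)\<^sup>2)" by (rule int_sum)
  have "(\<Sum>S\<in>F. \<Sum>i<k. \<Sum>S'\<in>F. \<Sum>j<k. c S i * c S' j * ?c S i S' j) = (\<Sum>S\<in>F. \<Sum>i<k. \<Sum>S'\<in>F. if S = S' then
      (\<Sum>j<k. c S i * c S' j * (\<integral>x. D i x * D j x \<partial>L) ^ card S) else 0)"
    by (intro sum.cong refl) auto
  also have "\<dots> = (\<Sum>S\<in>F. \<Sum>i<k. \<Sum>j<k. c S i * c S j * (\<integral>x. D i x * D j x \<partial>L) ^ card S)"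
    using finF by (simp add: sum.delta)
  finally show "expectation (\<lambda>\<omega>. (\<Sum>S\<in>F. \<Sum>i<k. c S i * ?m S i \<omega>)\<^sup>2) = \<dots>"
    using E_sum by simp
qed

section \<open>Frobenius norm of a matrix with a bounded quadratic form\<close>

text \<open>
  The squared Frobenius norm is the sum of the squared eigenvalues, which lie between \<open>0\<close> and \<open>s\<close>.
  The proof avoids eigenvalues and shows that each row \<open>v = C d\<close>, for a unit vector \<open>d\<close> of the
  standard basis, has squared norm at most \<open>s\<^sup>2\<close>: the form is nonnegative at \<open>s d - v\<close>, its values at
  \<open>d\<close> and \<open>v\<close> are at most \<open>s\<close> and \<open>s \<bar>v\<bar>\<^sup>2\<close>, and its mixed value at \<open>d\<close> and \<open>v\<close> is \<open>\<bar>v\<bar>\<^sup>2\<close>, so that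
  \<open>0 \<le> s\<^sup>3 - 2 s \<bar>v\<bar>\<^sup>2 + s \<bar>v\<bar>\<^sup>2\<close>.
\<close>

lemma frobenius_le_of_quadratic_form_bounds:
  fixes C :: "nat \<Rightarrow> nat \<Rightarrow> real"
  assumes sym: "\<And>i j. C i j = C j i" and s: "s > 0"
    and nonneg: "\<And>a. 0 \<le> (\<Sum>i<k. \<Sum>j<k. a i * a j * C i j)"
    and bound: "\<And>a. (\<Sum>i<k. \<Sum>j<k. a i * a j * C i j) \<le> s * (\<Sum>i<k. (a i)\<^sup>2)"
  shows "(\<Sum>i<k. \<Sum>j<k. (C i j)\<^sup>2) \<le> real k * s\<^sup>2"
proof -
  have row: "(\<Sum>j<k. (C i j)\<^sup>2) \<le> s\<^sup>2" if i: "i < k" for i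
  proof -
    define d :: "nat \<Rightarrow> real" where "d j = (if j = i then 1 else 0)" for j
    let ?N = "\<Sum>j<k. (C i j)\<^sup>2" and ?Q = "\<Sum>p<k. \<Sum>q<k. C i p * C i q * C p q"
    have pick: "(\<Sum>p<k. d p * g p) = g i" for g
    proof -
      have "(\<Sum>p<k. d p * g p) = (\<Sum>p<k. if p = i then g p else 0)"
        by (intro sum.cong) (auto simp: d_def)
      then show ?thesis using i by (simp add: sum.delta)
    qed
    have form: "(\<Sum>p<k. \<Sum>q<k. d p * b q * C p q) = (\<Sum>q<k. b q * C i q)" for b
    proof -
      have "(\<Sum>p<k. \<Sum>q<k. d p * b q * C p q) = (\<Sum>p<k. d p * (\<Sum>q<k. b q * C p q))"
        by (simp add: sum_distrib_left mult_ac)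
      then show ?thesis by (simp add: pick)
    qed
    have dd: "(\<Sum>p<k. \<Sum>q<k. d p * d q * C p q) = C i i"
      unfolding form by (rule pick)
    have dv: "(\<Sum>p<k. \<Sum>q<k. d p * C i q * C p q) = ?N"
      unfolding form by (simp add: power2_eq_square)
    have vd: "(\<Sum>p<k. \<Sum>q<k. C i p * d q * C p q) = ?N"
    proof -
      have "(\<Sum>p<k. \<Sum>q<k. C i p * d q * C p q) = (\<Sum>p<k. C i p * (\<Sum>q<k. d q * C p q))"
        by (simp add: sum_distrib_left mult_ac)
      then show ?thesis by (simp add: pick sym[of _ i] power2_eq_square)
    qed
    have "(\<Sum>p<k. (d p)\<^sup>2) = 1"
      using pick[of d] by (simp add: power2_eq_square d_def)
    then have "C i i \<le> s" using bound[of d] dd by simp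
    moreover have "?Q \<le> s * ?N" using bound[of "C i"] .
    moreover have "0 \<le> s\<^sup>2 * C i i - 2 * s * ?N + ?Q"
    proof -
      have "(\<Sum>p<k. \<Sum>q<k. (s * d p - C i p) * (s * d q - C i q) * C p q)
          = s\<^sup>2 * (\<Sum>p<k. \<Sum>q<k. d p * d q * C p q) - s * (\<Sum>p<k. \<Sum>q<k. d p * C i q * C p q)
            - s * (\<Sum>p<k. \<Sum>q<k. C i p * d q * C p q) + ?Q"
        unfolding sum_distrib_left sum_subtractf[symmetric] sum.distrib[symmetric]
        by (intro sum.cong refl) (simp add: algebra_simps power2_eq_square)
      then show ?thesis
        using nonneg[of "\<lambda>p. s * d p - C i p"] unfolding dd dv vd by simp
    qed
    moreover have "s\<^sup>2 * C i i \<le> s\<^sup>2 * s" using \<open>C i i \<le> s\<close> by (intro mult_left_mono) auto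
    ultimately have "s * ?N \<le> s * s\<^sup>2" by (simp add: algebra_simps)
    then show ?thesis using s by simp
  qed
  show ?thesis using sum_mono[of "{..<k}" "\<lambda>i. \<Sum>j<k. (C i j)\<^sup>2" "\<lambda>_. s\<^sup>2"] row by simp
qed

section \<open>Moments under a bounded density\<close>

text \<open>
  The bound \<open>B\<close> keeps the extended real essential supremum finite, so that its conversion to a real
  number loses nothing. It is positive because a density cannot vanish almost everywhere.
\<close>

lemma sup_norm_bounds:
  assumes "prob_density M f" "AE x in M. \<bar>f x\<bar> \<le> B"
  shows "AE x in M. f x \<le> sup_norm M f" and "0 < sup_norm M f"
proof -
  have f[measurable]: "f \<in> borel_measurable M" and f0: "AE x in M. 0 \<le> f x"
    and f1: "(\<integral>\<^sup>+x. ennreal (f x) \<partial>M) = 1"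
    using assms(1) by (auto simp: prob_density_def)
  let ?E = "esssup M (\<lambda>x. ereal \<bar>f x\<bar>)"
  have up: "?E \<le> ereal B" using assms(2) by (intro esssup_I) auto
  have pos: "\<not> (AE x in M. f x \<le> 0)"
  proof
    assume "AE x in M. f x \<le> 0"
    then have "(\<integral>\<^sup>+x. ennreal (f x) \<partial>M) = (\<integral>\<^sup>+x. 0 \<partial>M)"
      by (intro nn_integral_cong_AE) (auto simp: ennreal_neg)
    then show False using f1 by simp
  qed
  have le: "AE x in M. ereal \<bar>f x\<bar> \<le> ?E" by (rule esssup_AE)
  have E0: "0 < ?E"
  proof (rule ccontr)
    assume "\<not> 0 < ?E"
    then have "?E \<le> ereal 0" by (simp add: not_less zero_ereal_def[symmetric])
    from le have "AE x in M. f x \<le> 0"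
    proof eventually_elim
      fix x assume "ereal \<bar>f x\<bar> \<le> ?E"
      from order_trans[OF this \<open>?E \<le> ereal 0\<close>] show "f x \<le> 0" by simp
    qed
    then show False using pos by simp
  qed
  have E: "?E = ereal (sup_norm M f)"
    unfolding sup_norm_def using up E0 by (cases ?E) auto
  show "0 < sup_norm M f" using E0 unfolding E by simp
  show "AE x in M. f x \<le> sup_norm M f" using le unfolding E by (auto elim!: eventually_mono)
qed

lemma second_moment_density_le:
  fixes f w :: "'a \<Rightarrow> real"
  assumes f[measurable]: "f \<in> borel_measurable M" and f0: "AE x in M. 0 \<le> f x"
    and fs: "AE x in M. f x \<le> s" and w: "w \<in> L2 M"
  shows "integrable (density M (\<lambda>x. ennreal (f x))) (\<lambda>x. (w x)\<^sup>2)"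
    and "(\<integral>x. (w x)\<^sup>2 \<partial>density M (\<lambda>x. ennreal (f x))) \<le> s * (\<integral>x. (w x)\<^sup>2 \<partial>M)"
proof -
  have [measurable]: "w \<in> borel_measurable M" and w2: "integrable M (\<lambda>x. (w x)\<^sup>2)"
    using w by (auto simp: L2_def)
  have le: "AE x in M. f x * (w x)\<^sup>2 \<le> s * (w x)\<^sup>2"
    using fs by eventually_elim (simp add: mult_right_mono)
  have int: "integrable M (\<lambda>x. f x * (w x)\<^sup>2)"
  proof (rule Bochner_Integration.integrable_bound)
    show "integrable M (\<lambda>x. s * (w x)\<^sup>2)" using w2 by simp
    show "AE x in M. norm (f x * (w x)\<^sup>2) \<le> norm (s * (w x)\<^sup>2)"
      using f0 fs by eventually_elim (simp add: mult_right_mono abs_mult)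
  qed auto
  show "integrable (density M (\<lambda>x. ennreal (f x))) (\<lambda>x. (w x)\<^sup>2)"
    using int f0 by (subst integrable_density) auto
  have "(\<integral>x. (w x)\<^sup>2 \<partial>density M (\<lambda>x. ennreal (f x))) = (\<integral>x. f x * (w x)\<^sup>2 \<partial>M)"
    using f0 by (subst integral_density) auto
  also have "\<dots> \<le> (\<integral>x. s * (w x)\<^sup>2 \<partial>M)" using int w2 le by (intro integral_mono_AE) auto
  finally show "(\<integral>x. (w x)\<^sup>2 \<partial>density M (\<lambda>x. ennreal (f x))) \<le> s * (\<integral>x. (w x)\<^sup>2 \<partial>M)" by simp
qed

lemma orthonormal_combination:
  assumes "orthonormal_basis_L2 M e"
  shows "(\<lambda>x. \<Sum>i<k. a i * e i x) \<in> L2 M"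
    and "(\<integral>x. (\<Sum>i<k. a i * e i x)\<^sup>2 \<partial>M) = (\<Sum>i<k. (a i)\<^sup>2)"
proof -
  have e[measurable]: "e i \<in> borel_measurable M" and e2: "integrable M (\<lambda>x. (e i x)\<^sup>2)"
    and orth: "(\<integral>x. e i x * e j x \<partial>M) = (if i = j then 1 else 0)" for i j
    using assms by (auto simp: orthonormal_basis_L2_def L2_def L2_inner_def)
  have int: "integrable M (\<lambda>x. e i x * e j x)" for i j
    by (rule integrable_mult_of_square_integrable[OF e e e2 e2])
  have expand: "(\<Sum>i<k. a i * e i x)\<^sup>2 = (\<Sum>i<k. \<Sum>j<k. a i * a j * (e i x * e j x))" for x
    unfolding power2_eq_square sum_product by (intro sum.cong refl) (simp add: mult_ac)
  show "(\<lambda>x. \<Sum>i<k. a i * e i x) \<in> L2 M"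
    unfolding L2_def using int by (simp add: expand)
  show "(\<integral>x. (\<Sum>i<k. a i * e i x)\<^sup>2 \<partial>M) = (\<Sum>i<k. (a i)\<^sup>2)"
    unfolding expand
    by (simp add: int orth sum.delta if_distrib power2_eq_square cong: if_cong)
qed

text \<open>
  The quadratic form of the covariance matrix is the variance of the combination
  \<open>\<Sum>i<k. a i * e i x\<close>, whose second moment under the density is at most \<open>s\<close> times its squared norm
  in \<open>L\<^sub>2(M)\<close>, which is \<open>\<Sum>i<k. (a i)\<^sup>2\<close> by orthonormality.
\<close>

lemma covariance_quadratic_form_bounds:
  fixes M :: "'a measure" and f :: "'a \<Rightarrow> real"
  defines "L \<equiv> density M (\<lambda>x. ennreal (f x))"
  assumes basis: "orthonormal_basis_L2 M e" and f: "prob_density M f"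
    and fs: "AE x in M. f x \<le> s"
  defines "D \<equiv> \<lambda>i x. e i x - fourier_coeffs M e f i"
  shows "integrable L (\<lambda>x. (D i x)\<^sup>2)" and "(\<integral>x. D i x \<partial>L) = 0"
    and "0 \<le> (\<Sum>i<k. \<Sum>j<k. a i * a j * (\<integral>x. D i x * D j x \<partial>L))"
    and "(\<Sum>i<k. \<Sum>j<k. a i * a j * (\<integral>x. D i x * D j x \<partial>L)) \<le> s * (\<Sum>i<k. (a i)\<^sup>2)"
proof -
  have fm[measurable]: "f \<in> borel_measurable M" and f0: "AE x in M. 0 \<le> f x"
    and f1: "(\<integral>\<^sup>+x. ennreal (f x) \<partial>M) = 1"
    using f by (auto simp: prob_density_def)
  interpret L: prob_space L
    by (rule prob_spaceI) (simp add: L_def emeasure_density f1 cong: nn_integral_cong_simp)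
  have eL2: "e i \<in> L2 M" for i using basis by (auto simp: orthonormal_basis_L2_def)
  then have em: "e i \<in> borel_measurable M" for i by (auto simp: L2_def)
  then have e[measurable]: "e i \<in> borel_measurable L" for i by (simp add: L_def)
  have e2: "integrable L (\<lambda>x. (e i x)\<^sup>2)" for i
    unfolding L_def by (rule second_moment_density_le(1)[OF fm f0 fs eL2])
  have e1: "integrable L (e i)" for i by (rule L.square_integrable_imp_integrable[OF e e2])
  have mean: "(\<integral>x. e i x \<partial>L) = fourier_coeffs M e f i" for i
    unfolding L_def fourier_coeffs_def L2_inner_def
    using f0 em by (subst integral_density) auto
  have D[measurable]: "D i \<in> borel_measurable L" for i by (simp add: D_def)
  have D2: "integrable L (\<lambda>x. (D i x)\<^sup>2)" for i
    unfolding D_def power2_diff using e1 e2 by simp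
  then show "integrable L (\<lambda>x. (D i x)\<^sup>2)" .
  show "(\<integral>x. D i x \<partial>L) = 0" unfolding D_def using e1 mean by (simp add: L.prob_space)
  have DD: "integrable L (\<lambda>x. D i x * D j x)" for i j
    by (rule integrable_mult_of_square_integrable[OF D D D2 D2])
  have expand: "(\<Sum>i<k. a i * D i x)\<^sup>2 = (\<Sum>i<k. \<Sum>j<k. a i * a j * (D i x * D j x))" for x
    unfolding power2_eq_square sum_product by (intro sum.cong refl) (simp add: mult_ac)
  have form: "(\<Sum>i<k. \<Sum>j<k. a i * a j * (\<integral>x. D i x * D j x \<partial>L)) = (\<integral>x. (\<Sum>i<k. a i * D i x)\<^sup>2 \<partial>L)"
    unfolding expand by (simp add: DD)
  show "0 \<le> (\<Sum>i<k. \<Sum>j<k. a i * a j * (\<integral>x. D i x * D j x \<partial>L))"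
    unfolding form by simp
  define w where "w x = (\<Sum>i<k. a i * e i x)" for x
  have wL2: "w \<in> L2 M" unfolding w_def by (rule orthonormal_combination(1)[OF basis])
  have w2: "integrable L (\<lambda>x. (w x)\<^sup>2)"
    unfolding L_def by (rule second_moment_density_le(1)[OF fm f0 fs wL2])
  have w1: "integrable L w" unfolding w_def[abs_def] using e1 by simp
  have "(\<Sum>i<k. a i * D i x) = w x - L.expectation w" for x
    unfolding D_def w_def using e1 by (simp add: mean right_diff_distrib sum_subtractf)
  then have "(\<integral>x. (\<Sum>i<k. a i * D i x)\<^sup>2 \<partial>L) = L.variance w" by simp
  also have "\<dots> = L.expectation (\<lambda>x. (w x)\<^sup>2) - (L.expectation w)\<^sup>2"
    by (rule L.variance_eq[OF w1 w2])
  also have "\<dots> \<le> L.expectation (\<lambda>x. (w x)\<^sup>2)" by simp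
  also have "\<dots> \<le> s * (\<integral>x. (w x)\<^sup>2 \<partial>M)"
    unfolding L_def by (rule second_moment_density_le(2)[OF fm f0 fs wL2])
  also have "\<dots> = s * (\<Sum>i<k. (a i)\<^sup>2)"
    unfolding w_def by (simp add: orthonormal_combination(2)[OF basis])
  finally show "(\<Sum>i<k. \<Sum>j<k. a i * a j * (\<integral>x. D i x * D j x \<partial>L)) \<le> s * (\<Sum>i<k. (a i)\<^sup>2)"
    unfolding form .
qed

section \<open>Mean square error of the statistic\<close>

definition pairs_and_singletons :: "nat \<Rightarrow> nat set set" where
  "pairs_and_singletons n = {S. S \<subseteq> {..<n} \<and> card S = 2} \<union> (\<lambda>r. {r}) ` {..<n}"

lemma sum_pairs_and_singletons:
  fixes h :: "nat set \<Rightarrow> real"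
  shows "(\<Sum>S\<in>pairs_and_singletons n. h S) = (\<Sum>S | S \<subseteq> {..<n} \<and> card S = 2. h S) + (\<Sum>r<n. h {r})"
proof -
  have "(\<Sum>S\<in>pairs_and_singletons n. h S)
      = (\<Sum>S | S \<subseteq> {..<n} \<and> card S = 2. h S) + (\<Sum>S\<in>(\<lambda>r. {r}) ` {..<n}. h S)"
    unfolding pairs_and_singletons_def
    by (intro sum.union_disjoint) (auto intro: finite_subset[of _ "Pow {..<n}"])
  then show ?thesis by (simp add: sum.reindex)
qed

text \<open>
  The coefficients of the monomials in the error of the statistic, for the index sets in
  \<open>pairs_and_singletons n\<close>. They carry a factor \<open>2\<close> because a pair of indices occurs in both orders,
  and in the linear part because either of the two factors may be the one replaced by its mean.
  The linear coefficient \<open>2 / n\<close> arises from the \<open>n - 1\<close> possible partners of each index.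
\<close>

definition hoeffding_coeff :: "nat \<Rightarrow> (nat \<Rightarrow> real) \<Rightarrow> nat set \<Rightarrow> nat \<Rightarrow> real" where
  "hoeffding_coeff n a S i = (if card S = 2 then 2 / (real n * (real n - 1)) else 2 / real n * a i)"

lemma R_stat_hoeffding_decomposition:
  fixes e :: "nat \<Rightarrow> 'a \<Rightarrow> real"
  assumes n: "n \<ge> 2"
  shows "R_stat e k n t x - sq_dist k \<theta> t
    = (\<Sum>S\<in>pairs_and_singletons n. \<Sum>i<k.
         hoeffding_coeff n (\<lambda>i. \<theta> i - t i) S i * (\<Prod>q\<in>S. e i (x q) - \<theta> i))"
proof -
  let ?N = "real n * (real n - 1)"
  have N: "?N \<noteq> 0" "real n \<noteq> 0" "real n - 1 \<noteq> 0" using n by auto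
  define y where "y i r = e i (x r) - \<theta> i" for i r
  define a where "a i = \<theta> i - t i" for i
  define U where "U i = (\<Sum>S | S \<subseteq> {..<n} \<and> card S = 2. \<Prod>q\<in>S. y i q)" for i
  define V where "V i = (\<Sum>r<n. y i r)" for i
  have "R_stat e k n t x
      = 1 / ?N * (\<Sum>i<k. \<Sum>r<n. \<Sum>s\<in>{..<n} - {r}. (y i r + a i) * (y i s + a i))"
  proof -
    have "(\<Sum>r<n. \<Sum>s\<in>{..<n} - {r}. \<Sum>i<k. (e i (x r) - t i) * (e i (x s) - t i))
        = (\<Sum>r<n. \<Sum>i<k. \<Sum>s\<in>{..<n} - {r}. (e i (x r) - t i) * (e i (x s) - t i))"
      by (intro sum.cong refl sum.swap)
    also have "\<dots> = (\<Sum>i<k. \<Sum>r<n. \<Sum>s\<in>{..<n} - {r}. (e i (x r) - t i) * (e i (x s) - t i))"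
      by (rule sum.swap)
    finally show ?thesis by (simp add: R_stat_def y_def a_def)
  qed
  also have "\<dots> = 1 / ?N * (\<Sum>i<k. 2 * U i + 2 * (real n - 1) * a i * V i + ?N * (a i)\<^sup>2)"
    by (simp add: sum_distinct_pairs_shift sum_distinct_pairs_eq_subsets U_def V_def)
  also have "\<dots> = (\<Sum>i<k. 2 / ?N * U i) + (\<Sum>i<k. 2 / real n * a i * V i) + sq_dist k \<theta> t"
    unfolding sum_distrib_left sq_dist_def a_def[symmetric] sum.distrib[symmetric]
    using N by (intro sum.cong refl) (simp add: field_simps)
  also have "(\<Sum>i<k. 2 / ?N * U i)
      = (\<Sum>S | S \<subseteq> {..<n} \<and> card S = 2. \<Sum>i<k. hoeffding_coeff n a S i * (\<Prod>q\<in>S. y i q))"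
    unfolding U_def sum_distrib_left
    by (subst sum.swap) (intro sum.cong refl, simp add: hoeffding_coeff_def)
  also have "(\<Sum>i<k. 2 / real n * a i * V i)
      = (\<Sum>r<n. \<Sum>i<k. hoeffding_coeff n a {r} i * (\<Prod>q\<in>{r}. y i q))"
    unfolding V_def sum_distrib_left by (subst sum.swap) (simp add: hoeffding_coeff_def)
  finally show ?thesis
    unfolding sum_pairs_and_singletons y_def a_def[abs_def] by simp
qed

text \<open>
  By the second moment formula, the mean square error is the sum over the \<open>n choose 2\<close> pairs, with
  squared entries of the covariance matrix, and over the \<open>n\<close> singletons, with its quadratic form at
  \<open>\<theta> - t\<close>. The two summands are bounded separately, and each gives one summand of \<open>tau\<^sup>2\<close>.
\<close>

lemma (in prob_space) R_stat_mean_square_error: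
  fixes N :: "'b measure" and X :: "nat \<Rightarrow> 'a \<Rightarrow> 'b" and e :: "nat \<Rightarrow> 'b \<Rightarrow> real"
  assumes basis: "orthonormal_basis_L2 N e" and f: "prob_density N f"
    and bdd: "AE x in N. \<bar>f x\<bar> \<le> B" and n: "n \<ge> 2" and sample: "iid_sample M N n X f"
  defines "\<theta> \<equiv> fourier_coeffs N e f"
  shows "integrable M (\<lambda>\<omega>. (R_stat e k n t (\<lambda>r. X r \<omega>) - sq_dist k \<theta> t)\<^sup>2)"
    and "expectation (\<lambda>\<omega>. (R_stat e k n t (\<lambda>r. X r \<omega>) - sq_dist k \<theta> t)\<^sup>2) \<le> (tau N k n f \<theta> t)\<^sup>2"
proof -
  let ?L = "density N (\<lambda>x. ennreal (f x))" and ?s = "sup_norm N f"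
  define D where "D i x = e i x - \<theta> i" for i x
  define C where "C i j = (\<integral>x. D i x * D j x \<partial>?L)" for i j
  define a where "a i = \<theta> i - t i" for i
  have em: "e i \<in> borel_measurable N" for i
    using basis by (auto simp: orthonormal_basis_L2_def L2_def)
  have D: "D i \<in> borel_measurable N" for i unfolding D_def[abs_def] using em by simp
  note sup = sup_norm_bounds[OF f bdd]
  note cov = covariance_quadratic_form_bounds[OF basis f sup(1), folded \<theta>_def, folded D_def, folded C_def]
  have ind: "indep_vars (\<lambda>_. N) X {..<n}"
    and law: "\<And>q. q \<in> {..<n} \<Longrightarrow> distr M N (X q) = ?L"
    using sample by (auto simp: iid_sample_def distributed_distr_eq_density)
  have F: "pairs_and_singletons n \<subseteq> Pow {..<n}" by (auto simp: pairs_and_singletons_def)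
  note moment = hoeffding_second_moment[OF finite_lessThan ind law D cov(1,2) F,
      where k = k and c = "hoeffding_coeff n a", folded C_def]
  have dec: "R_stat e k n t (\<lambda>r. X r \<omega>) - sq_dist k \<theta> t
      = (\<Sum>S\<in>pairs_and_singletons n. \<Sum>i<k. hoeffding_coeff n a S i * (\<Prod>q\<in>S. D i (X q \<omega>)))" for \<omega>
    unfolding R_stat_hoeffding_decomposition[OF n] a_def D_def ..
  show "integrable M (\<lambda>\<omega>. (R_stat e k n t (\<lambda>r. X r \<omega>) - sq_dist k \<theta> t)\<^sup>2)"
    unfolding dec by (rule moment(1))
  let ?N = "real n * (real n - 1)"
  have N: "?N > 0" "real n > 0" using n by auto
  have choose: "real (n choose 2) = ?N / 2"
  proof -
    have "even (n * (n - 1))" by auto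
    then have "real (n choose 2) = real (n * (n - 1)) / 2"
      by (simp add: choose_two real_of_nat_div)
    then show ?thesis using n by (simp add: of_nat_diff)
  qed
  have "expectation (\<lambda>\<omega>. (R_stat e k n t (\<lambda>r. X r \<omega>) - sq_dist k \<theta> t)\<^sup>2)
      = (\<Sum>S\<in>pairs_and_singletons n. \<Sum>i<k. \<Sum>j<k.
           hoeffding_coeff n a S i * hoeffding_coeff n a S j * C i j ^ card S)"
    unfolding dec by (rule moment(2))
  also have "\<dots> = (\<Sum>S | S \<subseteq> {..<n} \<and> card S = 2. \<Sum>i<k. \<Sum>j<k. (2 / ?N)\<^sup>2 * (C i j)\<^sup>2)
      + (\<Sum>r<n. \<Sum>i<k. \<Sum>j<k. (2 / real n)\<^sup>2 * (a i * a j * C i j))"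
    unfolding sum_pairs_and_singletons hoeffding_coeff_def
    by (intro arg_cong2[where f = "(+)"] sum.cong refl) (auto simp: power2_eq_square)
  also have "\<dots> = real (n choose 2) * ((2 / ?N)\<^sup>2 * (\<Sum>i<k. \<Sum>j<k. (C i j)\<^sup>2))
      + real n * ((2 / real n)\<^sup>2 * (\<Sum>i<k. \<Sum>j<k. a i * a j * C i j))"
    by (simp add: n_subsets sum_distrib_left)
  also have "\<dots> = 2 / ?N * (\<Sum>i<k. \<Sum>j<k. (C i j)\<^sup>2) + 4 / real n * (\<Sum>i<k. \<Sum>j<k. a i * a j * C i j)"
    unfolding choose using N by (simp add: power2_eq_square)
  also have "\<dots> \<le> 2 / ?N * (real k * ?s\<^sup>2) + 4 / real n * (?s * (\<Sum>i<k. (a i)\<^sup>2))"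
    using N sup(2) cov(3,4)
    by (intro add_mono mult_left_mono frobenius_le_of_quadratic_form_bounds)
       (auto simp: C_def mult.commute)
  also have "\<dots> = (tau N k n f \<theta> t)\<^sup>2"
    using N sup(2) unfolding tau_def sq_dist_def a_def[symmetric]
    by (subst real_sqrt_pow2)
       (auto intro!: add_nonneg_nonneg divide_nonneg_nonneg mult_nonneg_nonneg sum_nonneg)
  finally show "expectation (\<lambda>\<omega>. (R_stat e k n t (\<lambda>r. X r \<omega>) - sq_dist k \<theta> t)\<^sup>2)
      \<le> (tau N k n f \<theta> t)\<^sup>2" .
qed

lemma R_stat_restrict: "R_stat e k n t (\<lambda>r\<in>{..<n}. x r) = R_stat e k n t x"
  unfolding R_stat_def by (intro arg_cong2[where f = "(*)"] sum.cong refl) auto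

theorem theorem4p1:
  fixes M :: "'a measure"
    and e :: "nat \<Rightarrow> 'a \<Rightarrow> real"
    and F :: "('a \<Rightarrow> real) set"
    and \<Omega> :: "'w measure"
    and P :: "(nat \<Rightarrow> real) \<Rightarrow> 'w measure"
    and X :: "nat \<Rightarrow> 'w \<Rightarrow> 'a"
    and T :: "'w \<Rightarrow> nat \<Rightarrow> real"
    and k n :: nat
  assumes basis: "orthonormal_basis_L2 M e"
    and F_L2: "F \<subseteq> L2 M"
    and F_density: "\<And>f. f \<in> F \<Longrightarrow> prob_density M f"
    and F_bounded: "uniformly_bounded M F"
    and n: "n \<ge> 2"
    and P_prob: "\<And>\<theta>. \<theta> \<in> Theta M e F \<Longrightarrow> prob_space (P \<theta>)"
    and P_sets: "\<And>\<theta>. \<theta> \<in> Theta M e F \<Longrightarrow> sets (P \<theta>) = sets \<Omega>"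
    and sample: "\<And>f. f \<in> F \<Longrightarrow> iid_sample (P (fourier_coeffs M e f)) M n X f"
    and T_measurable: "T \<in> measurable \<Omega> ell2"
    and T_indep: "\<And>\<theta>. \<theta> \<in> Theta M e F \<Longrightarrow>
        indep_rv (P \<theta>) (Pi\<^sub>M {..<n} (\<lambda>_. M)) (\<lambda>\<omega>. \<lambda>r\<in>{..<n}. X r \<omega>) ell2 T"
  shows "\<forall>\<omega>\<in>space \<Omega>.
      (SUP \<theta>\<in>Theta M e F. SUP f\<in>{f \<in> F. fourier_coeffs M e f = \<theta>}.
         cond_expectation_given (P \<theta>) M n X T
           (\<lambda>x t. ennreal (((R_stat e k n t x - sq_dist k \<theta> t) / tau M k n f \<theta> t)\<^sup>2)) \<omega>) \<le> 1"
proof (intro ballI SUP_least)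
  fix \<omega> \<theta> f
  assume \<theta>: "\<theta> \<in> Theta M e F" and "f \<in> {f \<in> F. fourier_coeffs M e f = \<theta>}"
  then have f: "f \<in> F" and \<theta>_eq: "\<theta> = fourier_coeffs M e f" by auto
  interpret prob_space "P \<theta>" by (rule P_prob[OF \<theta>])
  obtain B where B: "AE x in M. \<bar>f x\<bar> \<le> B"
    using F_bounded f by (auto simp: uniformly_bounded_def)
  define t where "t = T \<omega>"
  let ?g = "\<lambda>x. ((R_stat e k n t x - sq_dist k \<theta> t) / tau M k n f \<theta> t)\<^sup>2"
  note smp = sample[OF f, folded \<theta>_eq]
  note mse = R_stat_mean_square_error[OF basis F_density[OF f] B n smp, folded \<theta>_eq,
      where k = k and t = t]
  have em[measurable]: "e i \<in> borel_measurable M" for i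
    using basis by (auto simp: orthonormal_basis_L2_def L2_def)
  have X[measurable]: "X r \<in> measurable (P \<theta>) M" if "r < n" for r
    using smp that by (auto simp: iid_sample_def distributed_measurable)
  have X_meas: "(\<lambda>\<omega>'. \<lambda>r\<in>{..<n}. X r \<omega>') \<in> measurable (P \<theta>) (Pi\<^sub>M {..<n} (\<lambda>_. M))"
    by (rule measurable_restrict) simp
  have R_meas[measurable]: "R_stat e k n t \<in> borel_measurable (Pi\<^sub>M {..<n} (\<lambda>_. M))"
  proof -
    have "(\<lambda>x. e i (x r)) \<in> borel_measurable (Pi\<^sub>M {..<n} (\<lambda>_. M))" if "r \<in> {..<n}" for i r
      using measurable_compose[OF measurable_component_singleton[OF that] em] by simp
    then show ?thesis
      unfolding R_stat_def[abs_def]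
      by (intro borel_measurable_times borel_measurable_const borel_measurable_sum
          borel_measurable_diff) auto
  qed
  have "cond_expectation_given (P \<theta>) M n X T
          (\<lambda>x t. ennreal (((R_stat e k n t x - sq_dist k \<theta> t) / tau M k n f \<theta> t)\<^sup>2)) \<omega>
      = (\<integral>\<^sup>+\<omega>'. ennreal (?g (\<lambda>r. X r \<omega>')) \<partial>P \<theta>)"
    unfolding cond_expectation_given_def t_def[symmetric]
    by (subst nn_integral_distr[OF X_meas]) (simp_all add: R_stat_restrict)
  also have "\<dots> = ennreal (expectation (\<lambda>\<omega>'. ?g (\<lambda>r. X r \<omega>')))"
    using mse(1) by (intro nn_integral_eq_integral) (auto simp: power_divide)
  also have "\<dots> \<le> ennreal 1"
  proof (rule ennreal_leI)
    have "expectation (\<lambda>\<omega>'. ?g (\<lambda>r. X r \<omega>'))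
        = expectation (\<lambda>\<omega>'. (R_stat e k n t (\<lambda>r. X r \<omega>') - sq_dist k \<theta> t)\<^sup>2)
          / (tau M k n f \<theta> t)\<^sup>2"
      by (simp add: power_divide)
    \<comment> \<open>The scale vanishes for \<open>k = 0\<close>; the quotient is then \<open>0\<close> by convention.\<close>
    also have "\<dots> \<le> 1"
      using mse(2) by (cases "tau M k n f \<theta> t = 0") (auto simp: divide_le_eq_1)
    finally show "expectation (\<lambda>\<omega>'. ?g (\<lambda>r. X r \<omega>')) \<le> 1" .
  qed
  finally show "cond_expectation_given (P \<theta>) M n X T
      (\<lambda>x t. ennreal (((R_stat e k n t x - sq_dist k \<theta> t) / tau M k n f \<theta> t)\<^sup>2)) \<omega> \<le> 1"
    by simp
qed

end
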